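(* Let $\theta\in(0,\pi/6)$ and set $$\kappa=\sin 3\theta=\sin\theta\,(3-4\sin^2\theta),$$ $$k^2=\frac{\sin^2\theta\,\sin 2\theta}{\cos^2(\theta+\pi/6)\cos(2\theta-\pi/6)},$$ and let $M>0$ be given by $$4M^2=\sqrt3\,(2+\cos 2\theta-\sqrt3\,\sin 2\theta)(\sqrt3\,\cos 2\theta+\sin 2\theta).$$ Then $$F(\tfrac13,\tfrac23;1;\kappa^2)=\frac{3}{2M}\,F(\tfrac12,\tfrac12;1;k^2).$$
   Context: $F(a,b;c;z)$ is the Gauss hypergeometric function ${}_2F_1(a,b;c;z)=\sum_{n\ge 0}\frac{(a)_n(b)_n}{(c)_n\,n!}z^n$. For $\theta\in(0,\pi/6)$ one has $0<\kappa<1$ and $0<k^2<1$. *)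

theory Defs
  imports "HOL-Analysis.Analysis"
begin

text \<open>
  The Gauss series. For generic parameters its radius of convergence is 1, so the value is
  only meaningful for \<open>\<bar>z\<bar> < 1\<close>; \<open>c\<close> must not be a non-positive integer.
\<close>

definition Gauss_F :: "real \<Rightarrow> real \<Rightarrow> real \<Rightarrow> real \<Rightarrow> real" where
  "Gauss_F a b c z =
     (\<Sum>n. pochhammer a n * pochhammer b n / (pochhammer c n * fact n) * z ^ n)"

lemma Gauss_F_eq_eval_fps:
  "Gauss_F a b c z = eval_fps (fps_hypergeo [a, b] [c] 1) z"
  by (simp add: Gauss_F_def eval_fps_def ac_simps)

end

theory Submission
  imports Defs
begin

text \<open>
  Put \<open>x = tan \<theta> / sqrt 3\<close>, so that \<open>0 < x < 1/3\<close>, and \<open>\<kappa>\<^sup>2\<close>, \<open>k\<^sup>2\<close> and \<open>(3 / (2 M))\<^sup>2\<close> become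
  rational functions of \<open>x\<close>. When \<open>a + b = 1\<close>, the function \<open>f = F(a, b; 1; -)\<close> satisfies the
  self-adjoint equation \<open>(z (1 - z) f')' = a b f\<close>. Hence both sides of the claimed identity, as
  functions of \<open>x\<close>, satisfy the same equation \<open>(P y')' = Q y\<close>, with \<open>P\<close> vanishing at \<open>0\<close>. Their
  weighted Wronskian is therefore constant and vanishes at \<open>0\<close>, so their quotient is constant,
  and both take the value \<open>1\<close> at \<open>0\<close>.
\<close>

section \<open>The Gauss series with \<open>a + b = 1\<close> and \<open>c = 1\<close>: convergence,
  positivity, differential equation\<close>

lemma summable_Gauss_F:
  fixes a b z :: real
  assumes "0 < a" "0 < b" "a + b = 1" "\<bar>z\<bar> < 1"
  shows "summable (\<lambda>n. pochhammer a n * pochhammer b n / (pochhammer 1 n * fact n) * z ^ n)"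
proof -
  let ?c = "\<lambda>n. pochhammer a n * pochhammer b n / (pochhammer 1 n * fact n)"
  \<comment> \<open>Both parameters lie in (0, 1), so each factor \<open>a + i\<close> is at most
    \<open>1 + i\<close>. The coefficients are thus bounded by 1, and the geometric series
    dominates.\<close>
  have "pochhammer a n \<le> fact n" "pochhammer b n \<le> fact n" for n
    using assms by (simp_all add: pochhammer_fact pochhammer_prod prod_mono)
  moreover have "0 < pochhammer a n" "0 < pochhammer b n" for n
    using assms by (auto intro: pochhammer_pos)
  ultimately have "\<bar>?c n\<bar> \<le> 1" for n
    using mult_mono[of "pochhammer a n" "fact n" "pochhammer b n" "fact n"]
    by (simp add: pochhammer_fact[symmetric] abs_mult less_imp_le)
  then have "norm (?c n * z ^ n) \<le> \<bar>z\<bar> ^ n" for n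
    using mult_right_mono[of "\<bar>?c n\<bar>" 1 "\<bar>z\<bar> ^ n"] by (simp add: abs_mult power_abs)
  moreover have "summable (\<lambda>n. \<bar>z\<bar> ^ n)"
    using assms by (intro summable_geometric) auto
  ultimately show ?thesis
    by (rule summable_comparison_test'[where N = 0, rotated])
qed

lemma Gauss_F_0 [simp]: "Gauss_F a b c 0 = 1"
  using powser_zero[of "\<lambda>n. pochhammer a n * pochhammer b n / (pochhammer c n * fact n)"]
  by (simp add: Gauss_F_def)

lemma Gauss_F_pos:
  fixes a b z :: real
  assumes "0 < a" "0 < b" "a + b = 1" "0 \<le> z" "z < 1"
  shows "0 < Gauss_F a b 1 z"
  unfolding Gauss_F_def
  by (rule suminf_pos2[where i = 0, OF summable_Gauss_F])
     (use assms in \<open>auto intro!: mult_nonneg_nonneg divide_nonneg_nonneg pochhammer_nonneg\<close>)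

text \<open>The equation is the coefficient recurrence in disguise: \<open>a + b = 1\<close> turns
  \<open>(n + a) * (n + b)\<close> into \<open>n * (n + 1) + a * b\<close>. Differentiating
  \<open>z * (1 - z) * f' z\<close> as a single function avoids any second derivative.\<close>

lemma Gauss_F_self_adjoint_ode:
  fixes a b :: real
  assumes ab: "0 < a" "0 < b" "a + b = 1"
  obtains f' where
    "\<And>z. \<bar>z\<bar> < 1 \<Longrightarrow> (Gauss_F a b 1 has_real_derivative f' z) (at z)"
    "\<And>z. \<bar>z\<bar> < 1 \<Longrightarrow>
       ((\<lambda>z. z * (1 - z) * f' z) has_real_derivative a * b * Gauss_F a b 1 z) (at z)"
proof -
  define c where "c = (\<lambda>n. pochhammer a n * pochhammer b n / (pochhammer 1 n * fact n))"
  define F where "F = Abs_fps c"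
  define G where "G = fps_X * ((1 - fps_X) * fps_deriv F)"
  have F_eval: "Gauss_F a b 1 = eval_fps F"
    by (simp add: fun_eq_iff Gauss_F_def eval_fps_def F_def c_def)
  have c_Suc: "(real n + 1)\<^sup>2 * c (Suc n) = (real n * (real n + 1) + a * b) * c n" for n
  proof -
    have "b = 1 - a" using ab by simp
    moreover have "pochhammer (1 :: real) n \<noteq> 0" "1 + real n \<noteq> 0"
      by (auto simp: pochhammer_fact[symmetric])
    ultimately show ?thesis
      by (simp add: c_def pochhammer_Suc divide_simps) (simp add: algebra_simps power2_eq_square)
  qed
  have G_deriv: "fps_deriv G = fps_const (a * b) * F"
  proof (rule fps_ext)
    fix n
    have "fps_nth (fps_deriv G) n = (real n + 1) * fps_nth G (n + 1)"
      by (simp only: fps_deriv_nth) simp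
    \<comment> \<open>The factor \<open>fps_X\<close> shifts the index by one. For
      \<open>n = 0\<close> the subtracted term is zero, hence the case split.\<close>
    also have "fps_nth G (n + 1) = (real n + 1) * c (Suc n) - real n * c n"
      by (cases n) (auto simp: G_def F_def left_diff_distrib fps_X_mult_nth simp del: fps_deriv_mult)
    also have "(real n + 1) * \<dots> = fps_nth (fps_const (a * b) * F) n"
      using c_Suc[of n] by (simp add: F_def algebra_simps power2_eq_square)
    finally show "fps_nth (fps_deriv G) n = fps_nth (fps_const (a * b) * F) n" .
  qed
  have F_rad: "1 \<le> fps_conv_radius F"
    unfolding fps_conv_radius_def
    by (rule conv_radius_geI_ex')
       (use summable_Gauss_F[OF ab] in \<open>auto simp: F_def c_def\<close>)
  then have F'_rad: "1 \<le> fps_conv_radius (fps_deriv F)"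
    using fps_conv_radius_deriv order_trans by blast
  have q_rad: "fps_conv_radius (1 - fps_X :: real fps) = \<infinity>"
    using fps_conv_radius_diff[of 1 "fps_X :: real fps"] by simp
  have qF'_rad: "1 \<le> fps_conv_radius ((1 - fps_X) * fps_deriv F)"
    using fps_conv_radius_mult[of "1 - fps_X" "fps_deriv F"] F'_rad q_rad by simp
  then have G_rad: "1 \<le> fps_conv_radius G"
    using fps_conv_radius_mult[of fps_X "(1 - fps_X) * fps_deriv F"] by (simp add: G_def)
  have in_disc: "ereal (norm z) < R" if "\<bar>z\<bar> < 1" "1 \<le> R" for z :: real and R
    using that by (metis ereal_less(3) order_less_le_trans real_norm_def)
  have G_eval: "eval_fps G z = z * (1 - z) * eval_fps (fps_deriv F) z" if "\<bar>z\<bar> < 1" for z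
    using that in_disc[OF _ F'_rad] in_disc[OF _ qF'_rad]
    by (simp add: G_def eval_fps_mult eval_fps_diff q_rad)
  show thesis
  proof (rule that)
    fix z :: real assume z: "\<bar>z\<bar> < 1"
    show "(Gauss_F a b 1 has_real_derivative eval_fps (fps_deriv F) z) (at z)"
      unfolding F_eval by (intro has_field_derivative_eval_fps in_disc[OF z F_rad])
    have "(eval_fps G has_real_derivative eval_fps (fps_const (a * b) * F) z) (at z)"
      using has_field_derivative_eval_fps[OF in_disc[OF z G_rad]] by (simp add: G_deriv)
    moreover have "eval_fps (fps_const (a * b) * F) z = a * b * Gauss_F a b 1 z"
      using in_disc[OF z F_rad] by (simp add: eval_fps_mult F_eval)
    moreover have "open {z :: real. \<bar>z\<bar> < 1}"
      by (intro open_Collect_less continuous_intros)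
    \<comment> \<open>\<open>G_eval\<close> identifies the product with \<open>eval_fps G\<close> on
      the open unit disc, which suffices to transfer the derivative.\<close>
    ultimately show "((\<lambda>z. z * (1 - z) * eval_fps (fps_deriv F) z)
        has_real_derivative a * b * Gauss_F a b 1 z) (at z)"
      using DERIV_cong[of "eval_fps G"] G_eval z
      by (auto elim: has_field_derivative_transform_within_open[where S = "{z. \<bar>z\<bar> < 1}"])
  qed
qed

section \<open>\<kappa>^2, k^2 and 3 / (2 M) as functions of x = tan \<theta> / sqrt 3\<close>

definition cubic_modulus :: "real \<Rightarrow> real" where
  "cubic_modulus x = 27 * x\<^sup>2 * (1 - x\<^sup>2)\<^sup>2 / (1 + 3 * x\<^sup>2) ^ 3"

definition elliptic_modulus :: "real \<Rightarrow> real" where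
  "elliptic_modulus x = 16 * x ^ 3 / ((1 - x) ^ 3 * (1 + 3 * x))"

definition multiplier :: "real \<Rightarrow> real" where
  "multiplier x = (1 + 3 * x\<^sup>2) / sqrt ((1 - x) ^ 3 * (1 + 3 * x))"

lemma one_plus_three_square_pos [simp]: "0 < 1 + 3 * (x :: real)\<^sup>2"
  by (rule add_pos_nonneg) auto

text \<open>With t = x^2, the cubic terms of (1 + 3t)^3 and 27t(1 - t)^2 cancel, and the difference
  is a perfect square.\<close>

lemma one_minus_cubic_modulus:
  "1 - cubic_modulus x = (1 - 9 * x\<^sup>2)\<^sup>2 / (1 + 3 * x\<^sup>2) ^ 3"
proof -
  have "1 + 3 * x\<^sup>2 \<noteq> 0" by (metis less_irrefl one_plus_three_square_pos)
  then show ?thesis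
    unfolding cubic_modulus_def by (simp add: divide_simps) algebra
qed

text \<open>16x^3 is twice the odd part of (1 - x)^3 (1 + 3x), so subtracting it amounts to
  replacing x by -x.\<close>

lemma one_minus_elliptic_modulus:
  assumes "0 \<le> x" "x < 1 / 3"
  shows "1 - elliptic_modulus x =
    (1 + x) ^ 3 * (1 - 3 * x) / ((1 - x) ^ 3 * (1 + 3 * x))"
proof -
  have "1 - x \<noteq> 0" "1 + 3 * x \<noteq> 0" using assms by auto
  then show ?thesis
    unfolding elliptic_modulus_def by (simp add: divide_simps) algebra
qed

lemma cubic_modulus_range:
  assumes "0 \<le> x" "x < 1 / 3"
  shows "0 \<le> cubic_modulus x" "cubic_modulus x < 1"
proof -
  show "0 \<le> cubic_modulus x" by (simp add: cubic_modulus_def less_imp_le)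
  have "9 * x\<^sup>2 < 1" using abs_square_less_1[of "3 * x"] assms by auto
  then have "0 < 1 - cubic_modulus x"
    unfolding one_minus_cubic_modulus by (auto intro!: divide_pos_pos)
  then show "cubic_modulus x < 1" by simp
qed

lemma elliptic_modulus_range:
  assumes "0 \<le> x" "x < 1 / 3"
  shows "0 \<le> elliptic_modulus x" "elliptic_modulus x < 1"
proof -
  show "0 \<le> elliptic_modulus x" using assms by (simp add: elliptic_modulus_def)
  have "0 < 1 - elliptic_modulus x"
    unfolding one_minus_elliptic_modulus[OF assms] using assms by simp
  then show "elliptic_modulus x < 1" by simp
qed

lemma multiplier_pos: "0 \<le> x \<Longrightarrow> x < 1 / 3 \<Longrightarrow> 0 < multiplier x"
  by (simp add: multiplier_def)

lemma DERIV_cubic_modulus: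
  "(cubic_modulus has_real_derivative
     54 * x * (1 - x\<^sup>2) * (1 - 9 * x\<^sup>2) / (1 + 3 * x\<^sup>2) ^ 4) (at x)"
proof -
  have "1 + 3 * x\<^sup>2 \<noteq> 0" by (metis less_irrefl one_plus_three_square_pos)
  then show ?thesis
    unfolding cubic_modulus_def
    by (auto intro!: derivative_eq_intros simp: divide_simps) algebra
qed

lemma DERIV_elliptic_modulus:
  assumes "0 \<le> x" "x < 1 / 3"
  shows "(elliptic_modulus has_real_derivative
     48 * x\<^sup>2 * (1 + x)\<^sup>2 / ((1 - x) ^ 4 * (1 + 3 * x)\<^sup>2)) (at x)"
proof -
  have "1 - x \<noteq> 0" "1 + 3 * x \<noteq> 0" using assms by auto
  then show ?thesis
    unfolding elliptic_modulus_def
    by (auto intro!: derivative_eq_intros simp: divide_simps) algebra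
qed

lemma multiplier_square:
  assumes "0 \<le> x" "x < 1 / 3"
  shows "(multiplier x)\<^sup>2 = (1 + 3 * x\<^sup>2)\<^sup>2 / ((1 - x) ^ 3 * (1 + 3 * x))"
  using assms by (simp add: multiplier_def power_divide)

text \<open>Stating the derivative through the rational logarithmic derivative keeps the square root
  out of later algebra.\<close>

lemma DERIV_multiplier:
  assumes "0 \<le> x" "x < 1 / 3"
  shows "(multiplier has_real_derivative
     multiplier x * (12 * x * (1 + x) / ((1 + 3 * x\<^sup>2) * (1 - x) * (1 + 3 * x)))) (at x)"
proof -
  define D where "D = (\<lambda>x :: real. (1 - x) ^ 3 * (1 + 3 * x))"
  have nz: "1 - x \<noteq> 0" "1 + 3 * x \<noteq> 0" "1 + 3 * x\<^sup>2 \<noteq> 0" "0 < D x"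
    using assms one_plus_three_square_pos[of x] less_irrefl
    by (auto simp: D_def simp del: one_plus_three_square_pos)
  have D': "(D has_real_derivative - 12 * x * (1 - x)\<^sup>2) (at x)"
    unfolding D_def by (auto intro!: derivative_eq_intros) algebra
  have "((\<lambda>x. (1 + 3 * x\<^sup>2) / sqrt (D x)) has_real_derivative
      (6 * x * sqrt (D x) - (1 + 3 * x\<^sup>2) * (- 12 * x * (1 - x)\<^sup>2 / (2 * sqrt (D x)))) / D x) (at x)"
    by (rule derivative_eq_intros D' refl | use nz in \<open>simp add: field_simps\<close>)+
  also have "(6 * x * sqrt (D x) - (1 + 3 * x\<^sup>2) * (- 12 * x * (1 - x)\<^sup>2 / (2 * sqrt (D x)))) / D x
     = (6 * x * D x + 6 * x * (1 - x)\<^sup>2 * (1 + 3 * x\<^sup>2)) / D x / sqrt (D x)"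
    using nz by (simp add: field_simps)
  also have "(6 * x * D x + 6 * x * (1 - x)\<^sup>2 * (1 + 3 * x\<^sup>2)) / D x
     = 12 * x * (1 + x) / ((1 - x) * (1 + 3 * x))"
    using nz(1,2) unfolding D_def by (simp add: divide_simps) algebra
  finally show ?thesis
    using nz by (simp add: multiplier_def[abs_def] D_def ac_simps)
qed

lemma DERIV_weight:
  "((\<lambda>x. 6 * x\<^sup>2 * (1 + x)\<^sup>2 * (1 - 3 * x) / (1 + 3 * x\<^sup>2) ^ 3) has_real_derivative
     6 * x * (1 - x\<^sup>2) * (1 + 3 * x) * (2 - 9 * x - 3 * x\<^sup>2) / (1 + 3 * x\<^sup>2) ^ 4) (at x)"
proof -
  have "1 + 3 * x\<^sup>2 \<noteq> 0" by (metis less_irrefl one_plus_three_square_pos)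
  then show ?thesis
    by (auto intro!: derivative_eq_intros simp: divide_simps) algebra
qed

section \<open>The transformation in the variable x, by the weighted Wronskian\<close>

theorem cubic_elliptic_transformation:
  assumes "0 < x" "x < 1 / 3"
  shows "Gauss_F (1/3) (2/3) 1 (cubic_modulus x) =
    multiplier x * Gauss_F (1/2) (1/2) 1 (elliptic_modulus x)"
proof -
  obtain f' where f':
    "\<And>z. \<bar>z\<bar> < 1 \<Longrightarrow> (Gauss_F (1/3) (2/3) 1 has_real_derivative f' z) (at z)"
    "\<And>z. \<bar>z\<bar> < 1 \<Longrightarrow>
       ((\<lambda>z. z * (1 - z) * f' z) has_real_derivative 2/9 * Gauss_F (1/3) (2/3) 1 z) (at z)"
    by (rule Gauss_F_self_adjoint_ode[of "1/3" "2/3"]) auto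
  obtain g' where g':
    "\<And>z. \<bar>z\<bar> < 1 \<Longrightarrow> (Gauss_F (1/2) (1/2) 1 has_real_derivative g' z) (at z)"
    "\<And>z. \<bar>z\<bar> < 1 \<Longrightarrow>
       ((\<lambda>z. z * (1 - z) * g' z) has_real_derivative 1/4 * Gauss_F (1/2) (1/2) 1 z) (at z)"
    by (rule Gauss_F_self_adjoint_ode[of "1/2" "1/2"]) auto
  define h where "h = (\<lambda>x. Gauss_F (1/3) (2/3) 1 (cubic_modulus x))"
  define w where "w = (\<lambda>x. Gauss_F (1/2) (1/2) 1 (elliptic_modulus x))"
  define m where "m = multiplier"
  define \<phi>' where "\<phi>' = (\<lambda>x :: real. 54 * x * (1 - x\<^sup>2) * (1 - 9 * x\<^sup>2) / (1 + 3 * x\<^sup>2) ^ 4)"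
  define \<psi>' where "\<psi>' = (\<lambda>x :: real. 48 * x\<^sup>2 * (1 + x)\<^sup>2 / ((1 - x) ^ 4 * (1 + 3 * x)\<^sup>2))"
  define s where "s = (\<lambda>x :: real. 12 * x * (1 + x) / ((1 + 3 * x\<^sup>2) * (1 - x) * (1 + 3 * x)))"
  define h' where "h' = (\<lambda>x. f' (cubic_modulus x) * \<phi>' x)"
  define w' where "w' = (\<lambda>x. g' (elliptic_modulus x) * \<psi>' x)"
  define A where "A = (\<lambda>x. cubic_modulus x * (1 - cubic_modulus x) * f' (cubic_modulus x))"
  define B where "B = (\<lambda>x. elliptic_modulus x * (1 - elliptic_modulus x) * g' (elliptic_modulus x))"
  \<comment> \<open>This is \<open>cubic_modulus x * (1 - cubic_modulus x) / \<phi>' x\<close> after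
    cancellation, which makes sense also at 0, where \<open>\<phi>'\<close> vanishes.\<close>
  define P where "P = (\<lambda>x :: real. (1 - 9 * x\<^sup>2) * x * (1 - x\<^sup>2) / (2 * (1 + 3 * x\<^sup>2)\<^sup>2))"
  \<comment> \<open>\<open>r * m = P * m'\<close>\<close>
  define r where "r = (\<lambda>x :: real. 6 * x\<^sup>2 * (1 + x)\<^sup>2 * (1 - 3 * x) / (1 + 3 * x\<^sup>2) ^ 3)"
  define r' where "r' = (\<lambda>x :: real.
    6 * x * (1 - x\<^sup>2) * (1 + 3 * x) * (2 - 9 * x - 3 * x\<^sup>2) / (1 + 3 * x\<^sup>2) ^ 4)"
  \<comment> \<open>\<open>W = P * (h' * (m * w) - h * (m * w)')\<close>, written so that \<open>W\<close> is differentiable without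
    reference to second derivatives of \<open>h\<close> and \<open>w\<close>\<close>
  define W where "W = (\<lambda>x. m x * w x * A x - h x * (r x * m x) * w x - h x * (3/2 * B x) / m x)"

  have nz: "1 - x \<noteq> 0" "1 + 3 * x \<noteq> 0" "1 + 3 * x\<^sup>2 \<noteq> 0" "m x \<noteq> 0"
    if "0 \<le> x" "x < 1/3" for x
    using that one_plus_three_square_pos[of x] multiplier_pos[OF that] less_irrefl
    by (auto simp: m_def simp del: one_plus_three_square_pos)
  have \<phi>_disc: "\<bar>cubic_modulus x\<bar> < 1" and \<psi>_disc: "\<bar>elliptic_modulus x\<bar> < 1"
    if "0 \<le> x" "x < 1/3" for x
    using cubic_modulus_range[OF that] elliptic_modulus_range[OF that] by auto
  have h_deriv: "(h has_real_derivative h' x) (at x)" if "0 \<le> x" "x < 1/3" for x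
    unfolding h_def h'_def \<phi>'_def
    by (rule DERIV_chain2 f'(1) \<phi>_disc[OF that] DERIV_cubic_modulus)+
  have w_deriv: "(w has_real_derivative w' x) (at x)" if "0 \<le> x" "x < 1/3" for x
    unfolding w_def w'_def \<psi>'_def
    by (rule DERIV_chain2 g'(1) \<psi>_disc[OF that] DERIV_elliptic_modulus that)+
  have A_deriv: "(A has_real_derivative 2/9 * h x * \<phi>' x) (at x)" if "0 \<le> x" "x < 1/3" for x
    unfolding A_def h_def \<phi>'_def
    by (rule DERIV_chain2[OF f'(2)] \<phi>_disc[OF that] DERIV_cubic_modulus)+
  have B_deriv: "(B has_real_derivative 1/4 * w x * \<psi>' x) (at x)" if "0 \<le> x" "x < 1/3" for x
    unfolding B_def w_def \<psi>'_def
    by (rule DERIV_chain2[OF g'(2)] \<psi>_disc[OF that] DERIV_elliptic_modulus that)+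
  have m_deriv: "(m has_real_derivative m x * s x) (at x)" if "0 \<le> x" "x < 1/3" for x
    unfolding m_def s_def by (rule DERIV_multiplier[OF that])
  have r_deriv: "(r has_real_derivative r' x) (at x)" for x
    unfolding r_def r'_def by (rule DERIV_weight)

  have A_eq: "A x = P x * h' x" if "0 \<le> x" "x < 1/3" for x
  proof -
    have "cubic_modulus x * (1 - cubic_modulus x) = P x * \<phi>' x"
      unfolding one_minus_cubic_modulus unfolding cubic_modulus_def P_def \<phi>'_def
      using nz(3)[OF that] by (simp add: divide_simps) algebra
    then show ?thesis by (simp add: A_def h'_def)
  qed
  have B_eq: "3/2 * B x = P x * (m x)\<^sup>2 * w' x" if "0 \<le> x" "x < 1/3" for x
  proof -
    have "3/2 * (elliptic_modulus x * (1 - elliptic_modulus x)) = P x * (m x)\<^sup>2 * \<psi>' x"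
      unfolding m_def multiplier_square[OF that] one_minus_elliptic_modulus[OF that]
      unfolding elliptic_modulus_def P_def \<psi>'_def
      using nz(1-3)[OF that] by (simp add: divide_simps) algebra
    then show ?thesis by (simp add: B_def w'_def)
  qed
  have r_eq: "r x = P x * s x" if "0 \<le> x" "x < 1/3" for x
    unfolding r_def P_def s_def
    using nz(1-3)[OF that] by (simp add: divide_simps) algebra
  \<comment> \<open>This matches the zeroth-order coefficients: it makes \<open>m * w\<close>
    satisfy \<open>(P * y')' = 2/9 * \<phi>' * y\<close>, the equation of \<open>h\<close>. Here 3/8
    is 3/2 times the 1/4 from the equation of \<open>w\<close>.\<close>
  have m_ode: "r' x + r x * s x = 2/9 * \<phi>' x - 3/8 * \<psi>' x / (m x)\<^sup>2" if "0 \<le> x" "x < 1/3" for x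
  proof -
    have "3/8 * \<psi>' x / (m x)\<^sup>2
        = 18 * x\<^sup>2 * (1 + x)\<^sup>2 / ((1 - x) * (1 + 3 * x) * (1 + 3 * x\<^sup>2)\<^sup>2)"
      unfolding m_def multiplier_square[OF that] \<psi>'_def
      using nz(1-3)[OF that] by (simp add: divide_simps) algebra
    moreover have "r' x + r x * s x = 2/9 * \<phi>' x
        - 18 * x\<^sup>2 * (1 + x)\<^sup>2 / ((1 - x) * (1 + 3 * x) * (1 + 3 * x\<^sup>2)\<^sup>2)"
      unfolding r'_def r_def s_def \<phi>'_def
      using nz(1-3)[OF that] by (simp add: divide_simps) algebra
    ultimately show ?thesis by simp
  qed

  have W_deriv: "(W has_real_derivative 0) (at x)" if x: "0 \<le> x" "x < 1/3" for x
  proof -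
    have "(W has_real_derivative
        (m x * s x * w x + w' x * m x) * A x + 2/9 * h x * \<phi>' x * (m x * w x)
        - ((h' x * (r x * m x) + (r' x * m x + m x * s x * r x) * h x) * w x + w' x * (h x * (r x * m x)))
        - ((h' x * (3/2 * B x) + 3/2 * (1/4 * w x * \<psi>' x) * h x) * m x
            - h x * (3/2 * B x) * (m x * s x)) / (m x * m x)) (at x)"
      unfolding W_def
      by (rule DERIV_diff DERIV_mult DERIV_divide DERIV_cmult nz(4) h_deriv w_deriv A_deriv B_deriv
            m_deriv r_deriv x)+
    \<comment> \<open>After substituting for \<open>A\<close>, \<open>B\<close> and
      \<open>r\<close>, every term containing \<open>h'\<close> or \<open>w'\<close> cancels; the
      bracket that remains vanishes by \<open>m_ode\<close>.\<close>
    also have "(m x * s x * w x + w' x * m x) * A x + 2/9 * h x * \<phi>' x * (m x * w x)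
        - ((h' x * (r x * m x) + (r' x * m x + m x * s x * r x) * h x) * w x + w' x * (h x * (r x * m x)))
        - ((h' x * (3/2 * B x) + 3/2 * (1/4 * w x * \<psi>' x) * h x) * m x
            - h x * (3/2 * B x) * (m x * s x)) / (m x * m x)
        = h x * w x * m x * (2/9 * \<phi>' x - 3/8 * \<psi>' x / (m x)\<^sup>2 - (r' x + r x * s x))"
      unfolding A_eq[OF x] B_eq[OF x] r_eq[OF x]
      using nz(4)[OF x] by (simp add: field_simps power2_eq_square)
    finally show ?thesis using m_ode[OF x] by simp
  qed
  have "W 0 = 0"
    by (simp add: W_def A_def B_def r_def cubic_modulus_def elliptic_modulus_def)
  have W_0: "W x = 0" if x: "0 < x" "x < 1/3" for x
  proof -
    have "continuous_on {0..x} W"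
      using x by (intro continuous_at_imp_continuous_on ballI DERIV_isCont[OF W_deriv]) auto
    then have "W x = W 0"
      using x by (intro DERIV_isconst_end W_deriv) auto
    then show ?thesis using \<open>W 0 = 0\<close> by simp
  qed

  have w_pos: "0 < w x" if "0 \<le> x" "x < 1/3" for x
    unfolding w_def using elliptic_modulus_range[OF that] by (intro Gauss_F_pos) auto
  define u where "u = (\<lambda>x. h x / (m x * w x))"
  have u_deriv: "(u has_real_derivative
      (h' x * (m x * w x) - h x * (m x * s x * w x + w' x * m x)) / (m x * w x * (m x * w x))) (at x)"
    if "0 \<le> x" "x < 1/3" for x
    unfolding u_def
    by (rule DERIV_divide DERIV_mult h_deriv w_deriv m_deriv that)+
       (use w_pos[OF that] nz(4)[OF that] in simp)
  \<comment> \<open>The numerator of \<open>u'\<close> is \<open>W / P\<close>. Since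
    \<open>P\<close> vanishes at 0, this works only for positive x; continuity of \<open>u\<close>
    covers the endpoint.\<close>
  have u_const: "(u has_real_derivative 0) (at x)" if x: "0 < x" "x < 1/3" for x
  proof -
    have "W x = P x * (h' x * (m x * w x) - h x * (m x * s x * w x + w' x * m x))"
      unfolding W_def A_eq[OF less_imp_le[OF x(1)] x(2)] B_eq[OF less_imp_le[OF x(1)] x(2)]
        r_eq[OF less_imp_le[OF x(1)] x(2)]
      using nz(4)[of x] x by (simp add: field_simps power2_eq_square)
    moreover have "P x \<noteq> 0"
    proof -
      have "9 * x\<^sup>2 < 1" using abs_square_less_1[of "3 * x"] x by auto
      moreover have "x\<^sup>2 < 1" using x by (auto simp: abs_square_less_1)
      ultimately show ?thesis
        using x nz(3)[of x] by (auto simp: P_def)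
    qed
    ultimately show ?thesis using u_deriv[of x] W_0[OF x] x by simp
  qed
  have "continuous_on {0..x} u"
    using assms by (intro continuous_at_imp_continuous_on ballI DERIV_isCont[OF u_deriv]) auto
  then have "u x = u 0"
    using assms by (intro DERIV_isconst_end u_const) auto
  also have "u 0 = 1"
    by (simp add: u_def h_def w_def m_def multiplier_def cubic_modulus_def elliptic_modulus_def)
  finally have "h x = m x * w x"
    using w_pos[of x] nz(4)[of x] assms by (simp add: u_def)
  then show ?thesis by (simp add: h_def m_def w_def)
qed

section \<open>Translation back to the angle \<theta>\<close>

theorem mainTheorem5:
  fixes \<theta> \<kappa> k M :: real
  assumes "0 < \<theta>" and "\<theta> < pi / 6"
    and "\<kappa> = sin (3 * \<theta>)"
    and "k\<^sup>2 = (sin \<theta>)\<^sup>2 * sin (2 * \<theta>) /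
                 ((cos (\<theta> + pi / 6))\<^sup>2 * cos (2 * \<theta> - pi / 6))"
    and "M > 0"
    and "4 * M\<^sup>2 = sqrt 3 * (2 + cos (2 * \<theta>) - sqrt 3 * sin (2 * \<theta>)) *
                     (sqrt 3 * cos (2 * \<theta>) + sin (2 * \<theta>))"
  shows "\<kappa> = sin \<theta> * (3 - 4 * (sin \<theta>)\<^sup>2) \<and>
         Gauss_F (1 / 3) (2 / 3) 1 (\<kappa>\<^sup>2) = 3 / (2 * M) * Gauss_F (1 / 2) (1 / 2) 1 (k\<^sup>2)"
proof -
  define x where "x = tan \<theta> / sqrt 3"
  define c where "c = cos \<theta>"
  define q where "q = sqrt (3 :: real)"
  have q: "q\<^sup>2 = 3" "0 < q" by (simp_all add: q_def)
  have c: "0 < c"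
    unfolding c_def using assms(1,2) by (intro cos_gt_zero) auto
  have "0 < tan \<theta>"
    using assms(1,2) by (intro tan_gt_zero) auto
  moreover have "tan \<theta> < 1 / sqrt 3"
    using tan_monotone[of \<theta> "pi / 6"] assms(1,2) by (simp add: tan_30)
  ultimately have x: "0 < x" "x < 1 / 3"
    using divide_strict_right_mono[of "tan \<theta>" "1 / sqrt 3" "sqrt 3"] by (simp_all add: x_def)
  have sin_eq: "sin \<theta> = q * x * c"
    using c q by (simp add: x_def c_def q_def tan_def)
  \<comment> \<open>Pythagoras in terms of x and c; it makes the double-angle quantities rational in
    x and \<open>q\<close>.\<close>
  have c2: "c\<^sup>2 * (1 + 3 * x\<^sup>2) = 1"
    using sin_cos_squared_add[of \<theta>] q
    by (simp add: sin_eq c_def[symmetric] power_mult_distrib algebra_simps)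
  then have c2_eq: "c\<^sup>2 = 1 / (1 + 3 * x\<^sup>2)"
    by (metis div_by_1 divide_divide_eq_right mult_cancel_right2 nonzero_eq_divide_eq one_neq_zero mult_zero_right)
  have sin2: "sin (2 * \<theta>) = 2 * q * x * c\<^sup>2"
    by (simp add: sin_double sin_eq c_def[symmetric] power2_eq_square)
  have cos2: "cos (2 * \<theta>) = (1 - 3 * x\<^sup>2) * c\<^sup>2"
    unfolding cos_double sin_eq c_def[symmetric] power_mult_distrib q(1)
    by (simp add: algebra_simps)
  have nz: "1 - x \<noteq> 0" "1 + 3 * x \<noteq> 0" "1 + 3 * x\<^sup>2 \<noteq> 0"
    using x one_plus_three_square_pos[of x] less_irrefl
    by (auto simp del: one_plus_three_square_pos)

  have \<kappa>_eq: "\<kappa> = sin \<theta> * (3 - 4 * (sin \<theta>)\<^sup>2)"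
  proof -
    have "\<kappa> = sin \<theta> * ((cos \<theta>)\<^sup>2 - (sin \<theta>)\<^sup>2) + cos \<theta> * (2 * sin \<theta> * cos \<theta>)"
      using sin_add[of \<theta> "2 * \<theta>"] unfolding assms(3) cos_double sin_double by simp
    then show ?thesis
      using sin_cos_squared_add[of \<theta>] by algebra
  qed
  have "\<kappa>\<^sup>2 = 3 * x\<^sup>2 * c\<^sup>2 * (3 - 12 * x\<^sup>2 * c\<^sup>2)\<^sup>2"
    unfolding \<kappa>_eq sin_eq power_mult_distrib q(1) by algebra
  also have "\<dots> = cubic_modulus x"
    unfolding c2_eq cubic_modulus_def using nz(3) by (simp add: divide_simps) algebra
  finally have \<kappa>2: "\<kappa>\<^sup>2 = cubic_modulus x" .

  have cos_plus: "cos (\<theta> + pi / 6) = q * c * (1 - x) / 2"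
    unfolding cos_add cos_30 sin_30 sin_eq c_def[symmetric] q_def[symmetric]
    by (simp add: field_simps)
  have cos_minus: "cos (2 * \<theta> - pi / 6) = q * c\<^sup>2 * (1 - x) * (1 + 3 * x) / 2"
    unfolding cos_diff cos_30 sin_30 sin2 cos2 q_def[symmetric]
    by (simp add: field_simps power2_eq_square)
  \<comment> \<open>Numerator and denominator both carry the factor \<open>q ^ 3 * c ^ 4\<close>, so
    the surds and c cancel.\<close>
  have "k\<^sup>2 = elliptic_modulus x"
    unfolding assms(4) cos_plus cos_minus sin2 sin_eq elliptic_modulus_def
    using nz c q(2) by (simp add: divide_simps) algebra
  moreover have "3 / (2 * M) = multiplier x"
  proof -
    have first_factor: "2 + cos (2 * \<theta>) - q * sin (2 * \<theta>) = 3 * (1 - x)\<^sup>2 * c\<^sup>2"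
    proof -
      have "q * (2 * q * x * c\<^sup>2) = q\<^sup>2 * (2 * x * c\<^sup>2)"
        by (simp add: power2_eq_square)
      \<comment> \<open>Writing the constant 2 as
        \<open>2 * (c\<^sup>2 * (1 + 3 * x\<^sup>2))\<close> exposes the common factor
        \<open>c\<^sup>2\<close>; what is left is 3(1 - x)^2.\<close>
      then have "2 + cos (2 * \<theta>) - q * sin (2 * \<theta>)
          = 2 * (c\<^sup>2 * (1 + 3 * x\<^sup>2)) + (1 - 3 * x\<^sup>2) * c\<^sup>2 - 3 * (2 * x * c\<^sup>2)"
        by (simp only: sin2 cos2 c2 q(1) mult_1_right)
      then show ?thesis
        by (simp add: algebra_simps power2_eq_square)
    qed
    have second_factor: "q * cos (2 * \<theta>) + sin (2 * \<theta>) = q * (1 - x) * (1 + 3 * x) * c\<^sup>2"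
      unfolding sin2 cos2 by (simp add: algebra_simps power2_eq_square)
    have "4 * M\<^sup>2 = q * (3 * (1 - x)\<^sup>2 * c\<^sup>2) * (q * (1 - x) * (1 + 3 * x) * c\<^sup>2)"
      unfolding assms(6) q_def[symmetric] first_factor second_factor ..
    also have "\<dots> = q\<^sup>2 * (3 * ((1 - x) ^ 3 * (1 + 3 * x)) * (c\<^sup>2)\<^sup>2)"
      by (simp add: power2_eq_square power3_eq_cube)
    also have "\<dots> = (3 / multiplier x)\<^sup>2"
      unfolding q(1) c2_eq power_divide multiplier_square[OF less_imp_le[OF x(1)] x(2)] by simp
    finally have "(2 * M)\<^sup>2 = (3 / multiplier x)\<^sup>2"
      by (simp add: power_mult_distrib)
    \<comment> \<open>Both sides are positive, so equality of squares suffices; this is where the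
      sign of M enters.\<close>
    then have "2 * M = 3 / multiplier x"
      by (rule power2_eq_imp_eq) (use assms(5) multiplier_pos[of x] x in simp_all)
    then show ?thesis
      using multiplier_pos[of x] x assms(5) by (simp add: field_simps)
  qed
  ultimately show ?thesis
    using \<kappa>_eq \<kappa>2 cubic_elliptic_transformation[OF x] by simp
qed

end
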